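(* Let $F$ be a field of characteristic zero, let $n\ge 1$ be an integer, and let $g_1,\dots,g_n:\mathbb{Z}\to F$ be additive and injective maps. Then the Lie algebra $W(g_p,n)$ is simple.
   Context: Definition of $W(g_p,n)$. Let $F$ be a field of characteristic zero and $g_p:\mathbb{Z}\to F$ ($1\le p\le n$) additive maps. $W(g_p,n)$ is the Lie algebra over $F$ with basis $$B=\left\{\binom{a_1}{i_1}\cdots\binom{a_n}{i_n}_k \;:\; a_1,\dots,a_n,i_1,\dots,i_n\in\mathbb{Z},\ 1\le k\le n\right\}$$ (these are formal symbols, not binomial coefficients). Abbreviate the symbol $\binom{a_1}{i_1}\cdots\binom{a_n}{i_n}_k$ by $\binom{a}{i}_k$ with $a=(a_1,\dots,a_n)$, $i=(i_1,\dots,i_n)\in\mathbb{Z}^n$, and let $\varepsilon_k\in\mathbb{Z}^n$ be the $k$-th standard basis vector. The bracket is the bilinear extension of $$\left[\binom{a}{i}_k,\binom{b}{j}_l\right]=g_k(b_k)\binom{a+b}{i+j}_l+j_k\binom{a+b}{i+j-\varepsilon_k}_l-g_l(a_l)\binom{a+b}{i+j}_k-i_l\binom{a+b}{i+j-\varepsilon_l}_k ,$$ where the integers $j_k$, $i_l$ are regarded as elements of $F$. *)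

theory Defs
  imports "HOL-Analysis.Finite_Cartesian_Product" "HOL-Library.Poly_Mapping"
begin

locale lie_algebra = vector_space scale
  for scale :: "'f::field \<Rightarrow> 'v::ab_group_add \<Rightarrow> 'v" +
  fixes bracket :: "'v \<Rightarrow> 'v \<Rightarrow> 'v"
  assumes linear_right: "Vector_Spaces.linear scale scale (bracket x)"
    and linear_left: "Vector_Spaces.linear scale scale (\<lambda>x. bracket x y)"
    and alternating: "bracket x x = 0"
    and jacobi: "bracket x (bracket y z) + bracket y (bracket z x) + bracket z (bracket x y) = 0"
begin

definition lie_ideal :: "'v set \<Rightarrow> bool" where
  "lie_ideal I \<longleftrightarrow> subspace I \<and> (\<forall>x. \<forall>y\<in>I. bracket x y \<in> I)"

end

locale simple_lie_algebra = lie_algebra +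
  assumes nonabelian: "\<exists>x y. bracket x y \<noteq> 0"
    and ideal_trivial: "lie_ideal I \<Longrightarrow> I = {0} \<or> I = UNIV"

text \<open>
  The type \<open>'n\<close> plays the role of \<open>{1, \<dots>, n}\<close>, and the key \<open>(a, i, k)\<close> that of the
  formal symbol with rows \<open>a\<close>, \<open>i\<close> and index \<open>k\<close>. The underlying vector space is that of
  finitely supported functions on these keys, so \<open>Poly_Mapping.single (a, i, k) c\<close> is the
  multiple by \<open>c\<close> of a basis symbol, and \<open>axis k 1\<close> is the \<open>k\<close>-th standard basis vector.
\<close>

type_synonym 'n W_symbol = "(int ^ 'n) \<times> (int ^ 'n) \<times> 'n"

type_synonym ('n, 'f) W = "'n W_symbol \<Rightarrow>\<^sub>0 'f"

definition W_scale :: "'f::field_char_0 \<Rightarrow> ('n::finite, 'f) W \<Rightarrow> ('n, 'f) W" where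
  "W_scale c u = Poly_Mapping.map ((*) c) u"

fun W_symbol_bracket ::
  "('n::finite \<Rightarrow> int \<Rightarrow> 'f::field_char_0) \<Rightarrow> 'n W_symbol \<Rightarrow> 'n W_symbol \<Rightarrow> ('n, 'f) W" where
  "W_symbol_bracket g (a, i, k) (b, j, l) =
     Poly_Mapping.single (a + b, i + j, l) (g k (b $ k))
   + Poly_Mapping.single (a + b, i + j - axis k 1, l) (of_int (j $ k))
   - Poly_Mapping.single (a + b, i + j, k) (g l (a $ l))
   - Poly_Mapping.single (a + b, i + j - axis l 1, k) (of_int (i $ l))"

definition W_bracket ::
  "('n::finite \<Rightarrow> int \<Rightarrow> 'f::field_char_0) \<Rightarrow> ('n, 'f) W \<Rightarrow> ('n, 'f) W \<Rightarrow> ('n, 'f) W" where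
  "W_bracket g u v =
     (\<Sum>s\<in>Poly_Mapping.keys u. \<Sum>t\<in>Poly_Mapping.keys v.
        W_scale (Poly_Mapping.lookup u s * Poly_Mapping.lookup v t) (W_symbol_bracket g s t))"

lemma lookup_W_scale [simp]:
  "Poly_Mapping.lookup (W_scale c u) s = c * Poly_Mapping.lookup u s"
  by (simp add: W_scale_def Poly_Mapping.map.rep_eq when_def)

lemma vector_space_W_scale: "vector_space W_scale"
  by unfold_locales (auto intro!: poly_mapping_eqI simp: lookup_add algebra_simps)

lemma W_bracket_symbols:
  "W_bracket g (Poly_Mapping.single s 1) (Poly_Mapping.single t 1) = W_symbol_bracket g s t"
  by (intro poly_mapping_eqI) (simp add: W_bracket_def)

end

theory Submission
  imports Defs "HOL-Library.Product_Plus"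
begin

text \<open>
  Let \<open>A\<close> be the ring spanned by the functions \<open>exp (\<Sum>\<^sub>k g\<^sub>k(a\<^sub>k) x\<^sub>k) * \<Prod>\<^sub>k x\<^sub>k ^ i\<^sub>k\<close>,
  that is, the group ring of \<open>\<int>\<^sup>n \<times> \<int>\<^sup>n\<close>, and let \<open>d\<^sub>k\<close> be the partial derivative by \<open>x\<^sub>k\<close>. Reading a
  symbol \<open>(a, i, k)\<close> as a monomial times \<open>d\<^sub>k\<close> identifies \<open>W\<close> with the Lie algebra of vector fields
  \<open>\<Sum>\<^sub>k u\<^sub>k d\<^sub>k\<close> with \<open>u\<^sub>k\<close> in \<open>A\<close> (\<open>vector_field_bracket\<close>). The Lie algebra axioms follow, as the bracket is a
  commutator of derivations.

  To prove that \<open>W\<close> is simple, let \<open>u\<close> be a nonzero element of an ideal \<open>I\<close>, and call conductor the set of all \<open>c\<close> in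
  \<open>A\<close> with \<open>c w\<close> in \<open>I\<close> for every field \<open>w\<close>. It is an ideal of \<open>A\<close> that is closed under all \<open>d\<^sub>k\<close>. Three facts
  show that it contains \<open>1\<close>, so that \<open>I\<close> is everything.

  First, a few brackets of \<open>u\<close> with multiples of itself and of arbitrary fields show that \<open>4 u(f)\<^sup>3\<close> is
  in the conductor for every \<open>f\<close> in \<open>A\<close> (\<open>cube_in_conductor\<close>). This holds over any commutative ring with commuting
  derivations.

  Second, for some \<open>f\<close> that element is nonzero (\<open>act_cube_nonzero\<close>). For \<open>f\<close> an exponential, \<open>u(f)\<close> is a
  component of \<open>u\<close> times a unit, because \<open>g\<^sub>k(1)\<close> is nonzero; and \<open>A\<close> has no nilpotent elements, since a point
  of the support farthest from the origin is extreme (\<open>square_eq_zero_coeff\<close>).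

  Third, a nonzero ideal of \<open>A\<close> that is closed under all \<open>d\<^sub>k\<close> contains \<open>1\<close> (\<open>one_in_differential_ideal\<close>). Multiplication
  by a monomial makes the exponents of a nonzero element nonnegative. The operators \<open>d\<^sub>k - g\<^sub>k(c)\<close>, with
  \<open>c\<close> suitably chosen, then shrink the element further and further; when each of them kills it, injectivity of the
  \<open>g\<^sub>k\<close> leaves room for a single exponential only, which is a unit.
\<close>

section \<open>Vector fields over a ring with commuting derivations\<close>

locale commuting_derivations =
  fixes d :: "'n::finite \<Rightarrow> 'a::comm_ring_1 \<Rightarrow> 'a"
  assumes add: "d k (x + y) = d k x + d k y"
    and leibniz: "d k (x * y) = d k x * y + x * d k y"
    and commute: "d k (d l x) = d l (d k x)"
begin

lemma zero [simp]: "d k 0 = 0"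
  using add[of k 0 0] by simp

lemma diff: "d k (x - y) = d k x - d k y"
  using add[of k "x - y" y] by (simp add: algebra_simps)

lemma sum: "d k (\<Sum>i\<in>S. f i) = (\<Sum>i\<in>S. d k (f i))"
  by (induction S rule: infinite_finite_induct) (simp_all add: add)

text \<open>
  A vector of coefficients stands for the vector field \<open>\<Sum>\<^sub>k u\<^sub>k d\<^sub>k\<close>; \<open>act\<close> is its action on the
  ring as a derivation, and \<open>lie\<close> is the commutator of two such fields, which is again such a field
  because the \<open>d\<^sub>k\<close> commute.
\<close>

definition act :: "'a ^ 'n \<Rightarrow> 'a \<Rightarrow> 'a" where
  "act u f = (\<Sum>k\<in>UNIV. u $ k * d k f)"

definition lie :: "'a ^ 'n \<Rightarrow> 'a ^ 'n \<Rightarrow> 'a ^ 'n" where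
  "lie u v = (\<chi> l. act u (v $ l) - act v (u $ l))"

lemma lie_nth [simp]: "lie u v $ l = act u (v $ l) - act v (u $ l)"
  by (simp add: lie_def)

lemma act_add: "act u (f + h) = act u f + act u h"
  by (simp add: act_def add algebra_simps sum.distrib)

lemma act_diff: "act u (f - h) = act u f - act u h"
  by (simp add: act_def diff algebra_simps sum_subtractf)

lemma act_leibniz: "act u (f * h) = act u f * h + f * act u h"
  by (simp add: act_def leibniz algebra_simps sum.distrib sum_distrib_left)

lemma act_add_left: "act (u + v) f = act u f + act v f"
  by (simp add: act_def algebra_simps sum.distrib)

lemma act_smult: "act (a *s u) f = a * act u f"
  by (simp add: act_def sum_distrib_left mult.assoc)

lemma act_axis: "act (axis k a) f = a * d k f"
  by (simp add: act_def axis_def if_distrib[of "\<lambda>x. x * _"] cong: if_cong)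

text \<open>
  Expanding a double action gives a part of first order in \<open>f\<close> and the part
  \<open>\<Sum> x\<^sub>k y\<^sub>l d\<^sub>k d\<^sub>l f\<close> of second order. The latter is symmetric in the two fields since the \<open>d\<^sub>k\<close>
  commute, so it cancels in the commutator.
\<close>

lemma act_lie: "act (lie u v) f = act u (act v f) - act v (act u f)"
proof -
  have expand: "act x (act y f) = (\<Sum>l\<in>UNIV. act x (y $ l) * d l f)
      + (\<Sum>l\<in>UNIV. \<Sum>k\<in>UNIV. x $ k * y $ l * d k (d l f))" for x y
    unfolding act_def[of y f]
    by (simp add: act_def sum leibniz sum_distrib_left sum_distrib_right algebra_simps
        sum.distrib sum.swap[of "\<lambda>k l. x $ k * (y $ l * d k (d l f))"]
        sum.swap[of "\<lambda>k l. x $ k * (d l f * d k (y $ l))"])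
  have "(\<Sum>l\<in>UNIV. \<Sum>k\<in>UNIV. u $ k * v $ l * d k (d l f))
      = (\<Sum>l\<in>UNIV. \<Sum>k\<in>UNIV. v $ k * u $ l * d k (d l f))"
    by (subst sum.swap) (simp add: commute mult.commute mult.left_commute)
  moreover have "act (lie u v) f
      = (\<Sum>l\<in>UNIV. act u (v $ l) * d l f) - (\<Sum>l\<in>UNIV. act v (u $ l) * d l f)"
    by (subst act_def) (simp add: algebra_simps sum_subtractf)
  ultimately show ?thesis
    by (simp add: expand)
qed

text \<open>
  After \<open>act_lie\<close> every component is a sum of twelve double actions that cancel in pairs.
\<close>

lemma lie_jacobi: "lie u (lie v w) + lie v (lie w u) + lie w (lie u v) = 0"
  by (simp add: vec_eq_iff act_lie act_diff)

lemma lie_self [simp]: "lie u u = 0"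
  by (simp add: vec_eq_iff)

lemma lie_swap: "lie u v = - lie v u"
  by (simp add: vec_eq_iff)

lemma lie_add_left: "lie (u + v) w = lie u w + lie v w"
  by (simp add: vec_eq_iff act_add act_add_left)

lemma lie_add_right: "lie w (u + v) = lie w u + lie w v"
  by (simp add: vec_eq_iff act_add act_add_left)

lemma lie_axis: "lie (axis k a) (axis l b) = axis l (a * d k b) - axis k (b * d l a)"
  by (simp add: vec_eq_iff act_axis) (simp add: axis_def)

lemma lie_smult_right: "lie u (a *s v) = act u a *s v + a *s lie u v"
  by (simp add: vec_eq_iff act_smult act_leibniz algebra_simps)

lemma lie_smult_left: "lie (a *s u) v = a *s lie u v - act v a *s u"
  by (simp add: vec_eq_iff act_smult act_leibniz algebra_simps)

definition differential_ideal :: "'a set \<Rightarrow> bool" where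
  "differential_ideal J \<longleftrightarrow> 0 \<in> J \<and> (\<forall>x\<in>J. \<forall>y\<in>J. x + y \<in> J)
     \<and> (\<forall>r. \<forall>x\<in>J. r * x \<in> J) \<and> (\<forall>k. \<forall>x\<in>J. d k x \<in> J)"

definition vector_field_ideal :: "('a ^ 'n) set \<Rightarrow> bool" where
  "vector_field_ideal I \<longleftrightarrow> 0 \<in> I \<and> (\<forall>u\<in>I. \<forall>v\<in>I. u - v \<in> I) \<and> (\<forall>w. \<forall>u\<in>I. lie w u \<in> I)"

text \<open>
  The scalars that throw the whole module of vector fields into \<open>I\<close>. If \<open>1\<close> is among them, then
  \<open>I\<close> is everything; so it suffices to see that the conductor is a nonzero differential ideal.
\<close>

definition conductor :: "('a ^ 'n) set \<Rightarrow> 'a set" where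
  "conductor I = {a. \<forall>w. a *s w \<in> I}"

context
  fixes I :: "('a ^ 'n) set"
  assumes I: "vector_field_ideal I"
begin

lemma ideal_zero: "0 \<in> I"
  and ideal_diff: "u \<in> I \<Longrightarrow> v \<in> I \<Longrightarrow> u - v \<in> I"
  and ideal_lie_right: "u \<in> I \<Longrightarrow> lie w u \<in> I"
  using I by (auto simp: vector_field_ideal_def)

lemma ideal_minus: "u \<in> I \<Longrightarrow> - u \<in> I"
  using ideal_diff[OF ideal_zero, of u] by simp

lemma ideal_add: "u \<in> I \<Longrightarrow> v \<in> I \<Longrightarrow> u + v \<in> I"
  using ideal_diff[of u "- v"] ideal_minus[of v] by simp

lemma ideal_lie_left: "u \<in> I \<Longrightarrow> lie u w \<in> I"
  using ideal_minus[OF ideal_lie_right[of u w]] lie_swap[of u w] by simp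

lemma differential_ideal_conductor: "differential_ideal (conductor I)"
  unfolding differential_ideal_def
proof (intro conjI ballI allI)
  show "0 \<in> conductor I"
    by (simp add: conductor_def ideal_zero)
  show "x + y \<in> conductor I" if "x \<in> conductor I" "y \<in> conductor I" for x y
    using that by (simp add: conductor_def ideal_add vector_sadd_rdistrib)
  show "r * x \<in> conductor I" if "x \<in> conductor I" for r x
    unfolding conductor_def
  proof (intro CollectI allI)
    fix w
    have "x *s (r *s w) \<in> I"
      using that unfolding conductor_def by blast
    then show "(r * x) *s w \<in> I"
      by (simp add: vector_smult_assoc mult.commute)
  qed
  show "d k x \<in> conductor I" if "x \<in> conductor I" for k x
    unfolding conductor_def
  proof (intro CollectI allI)
    fix w
    have x: "x *s v \<in> I" for v
      using that by (simp add: conductor_def)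
    have "act (axis k 1) x *s w = lie (axis k 1) (x *s w) - x *s lie (axis k 1) w"
      by (simp add: lie_smult_right)
    also have "\<dots> \<in> I"
      by (intro ideal_diff ideal_lie_right x)
    finally show "d k x *s w \<in> I"
      by (simp add: act_axis)
  qed
qed

lemma act_smult_self_in_ideal:
  assumes "u \<in> I" shows "act u a *s u \<in> I"
  using ideal_lie_left[OF assms, of "a *s u"] by (simp add: lie_smult_right)

text \<open>
  Put \<open>v = u(a) u\<close>, which lies in \<open>I\<close>. The bracket of \<open>v\<close> with \<open>b u\<close> is
  \<open>(u(a) u(b) - b u(u(a))) u\<close>, while the preceding lemma with \<open>b u(a)\<close> in the place of \<open>a\<close> gives
  \<open>(u(a) u(b) + b u(u(a))) u\<close>. In the difference the term \<open>u(b)\<close> disappears, and \<open>b\<close> is left as a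
  free factor.
\<close>

lemma double_act_smult_in_ideal:
  assumes "u \<in> I" shows "(b * (2 * act u (act u a))) *s u \<in> I"
proof -
  let ?v = "act u a *s u"
  have "lie ?v (b *s u) = (act u a * act u b - b * act u (act u a)) *s u"
    by (simp add: lie_smult_right lie_smult_left act_smult vec_eq_iff algebra_simps)
  moreover have "act u (b * act u a) = act u a * act u b + b * act u (act u a)"
    by (simp add: act_leibniz mult.commute)
  ultimately have "(b * (2 * act u (act u a))) *s u = act u (b * act u a) *s u - lie ?v (b *s u)"
    by (simp add: vec_eq_iff algebra_simps)
  also have "\<dots> \<in> I"
    by (intro ideal_diff act_smult_self_in_ideal ideal_lie_left assms)
  finally show ?thesis .
qed

text \<open>
  If all multiples of \<open>v\<close> lie in \<open>I\<close>, then so do those of every bracket with \<open>v\<close>, since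
  \<open>[f v, e] = f [v, e] - e(f) v\<close>. Hence \<open>[v, f e] = v(f) e + f [v, e]\<close> leaves \<open>v(f) e\<close> in \<open>I\<close>.
\<close>

lemma act_in_conductor:
  assumes v: "\<And>b. b *s v \<in> I" shows "act v f \<in> conductor I"
  unfolding conductor_def
proof (intro CollectI allI)
  fix e
  have "f *s lie v e = lie (f *s v) e + act e f *s v"
    by (simp add: lie_smult_left)
  also have "\<dots> \<in> I"
    by (intro ideal_add ideal_lie_left v)
  finally have "lie v (f *s e) - f *s lie v e \<in> I"
    using v[of 1] by (intro ideal_diff ideal_lie_left) auto
  then show "act v f *s e \<in> I"
    by (simp add: lie_smult_right)
qed

text \<open>
  The two preceding lemmas put \<open>2 u(u(h)) u(a)\<close> into the conductor for every \<open>h\<close>. Taking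
  \<open>h = a\<^sup>2\<close>, where \<open>u(u(a\<^sup>2)) = 2 a u(u(a)) + 2 u(a)\<^sup>2\<close>, and removing the multiple of
  \<open>u(u(a)) u(a)\<close> leaves a cube.
\<close>

lemma cube_in_conductor:
  assumes "u \<in> I" shows "4 * act u a ^ 3 \<in> conductor I"
proof -
  have J: "2 * act u (act u h) * act u a \<in> conductor I" for h
    using act_in_conductor[of "(2 * act u (act u h)) *s u" a] double_act_smult_in_ideal[OF assms]
    by (simp add: act_smult vector_smult_assoc)
  have add: "x + y \<in> conductor I" if "x \<in> conductor I" "y \<in> conductor I" for x y
    using differential_ideal_conductor that by (simp add: differential_ideal_def)
  have mult: "r * x \<in> conductor I" if "x \<in> conductor I" for r x
    using differential_ideal_conductor that by (simp add: differential_ideal_def)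
  \<comment> \<open>the case h = a * a of J, corrected by a multiple of the case h = a\<close>
  have "4 * act u a ^ 3 = 2 * act u (act u (a * a)) * act u a
      + (- 2 * a) * (2 * act u (act u a) * act u a)"
    unfolding act_leibniz act_add by (simp add: algebra_simps power3_eq_cube)
  also have "\<dots> \<in> conductor I"
    by (intro add mult J)
  finally show ?thesis .
qed

theorem vector_field_ideal_eq_UNIV:
  assumes simple: "\<And>J x. differential_ideal J \<Longrightarrow> x \<in> J \<Longrightarrow> x \<noteq> 0 \<Longrightarrow> 1 \<in> J"
    and "u \<in> I" "4 * act u a ^ 3 \<noteq> 0"
  shows "I = UNIV"
proof -
  have "1 \<in> conductor I"
    using simple[OF differential_ideal_conductor cube_in_conductor] assms(2,3) .
  then show ?thesis
    by (auto simp: conductor_def)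
qed

end

end

section \<open>The coefficient ring and its derivations\<close>

text \<open>
  The group ring of the keys \<open>(a, i)\<close>, with convolution as product: \<open>Poly_Mapping.single (a, i) 1\<close>
  is to be thought of as the function \<open>exp (\<Sum>\<^sub>k g\<^sub>k(a\<^sub>k) x\<^sub>k) * \<Prod>\<^sub>k x\<^sub>k ^ i\<^sub>k\<close>.
\<close>

type_synonym ('n, 'f) coeff = "(int ^ 'n) \<times> (int ^ 'n) \<Rightarrow>\<^sub>0 'f"

lemma poly_mapping_additive_induct [case_names zero single add]:
  assumes "P 0" and "\<And>s c. P (Poly_Mapping.single s c)"
    and "\<And>p q. P p \<Longrightarrow> P q \<Longrightarrow> P (p + q)"
  shows "P (p :: 'a \<Rightarrow>\<^sub>0 'b::monoid_add)"
proof (induction p rule: update_induct)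
  case const
  show ?case by (rule assms)
next
  case (update p s c)
  have "Poly_Mapping.update s c p = p + Poly_Mapping.single s c"
    using update(1) by (intro poly_mapping_eqI)
      (auto simp: lookup_update lookup_add lookup_single when_def in_keys_iff)
  then show ?case
    using update assms by simp
qed

lemma lookup_single_mult:
  fixes p :: "'a::ab_group_add \<Rightarrow>\<^sub>0 'b::comm_ring_1"
  shows "Poly_Mapping.lookup (Poly_Mapping.single s c * p) t = c * Poly_Mapping.lookup p (t - s)"
  by (induction p rule: poly_mapping_additive_induct)
    (auto simp: mult_single lookup_single lookup_add distrib_left when_def algebra_simps)

lemma lookup_mult_keys:
  fixes p q :: "'a::ab_group_add \<Rightarrow>\<^sub>0 'b::comm_ring_1"
  shows "Poly_Mapping.lookup (p * q) t
    = (\<Sum>s\<in>Poly_Mapping.keys p. Poly_Mapping.lookup p s * Poly_Mapping.lookup q (t - s))"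
proof -
  have "p = (\<Sum>s\<in>Poly_Mapping.keys p. Poly_Mapping.single s (Poly_Mapping.lookup p s))"
    by (intro poly_mapping_eqI) (auto simp: lookup_sum lookup_single when_def in_keys_iff)
  from arg_cong[OF this, of "\<lambda>r. Poly_Mapping.lookup (r * q) t"] show ?thesis
    by (simp add: sum_distrib_right lookup_sum lookup_single_mult)
qed

lemma ex_maximal_value:
  fixes f :: "'a \<Rightarrow> 'b::linorder"
  assumes "finite S" "S \<noteq> {}"
  shows "\<exists>s\<in>S. \<forall>t\<in>S. f t \<le> f s"
proof -
  have "Max (f ` S) \<in> f ` S"
    using assms by (intro Max_in) auto
  then obtain s where "s \<in> S" "f s = Max (f ` S)"
    by auto
  then show ?thesis
    using assms(1) by (intro bexI[of _ s]) auto
qed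

text \<open>
  A point \<open>s\<close> of the support that is farthest from the origin is extreme: by the parallelogram law
  \<open>s + s\<close> is the sum of two points of the support only as \<open>s + s\<close>. So the coefficient of \<open>p\<^sup>2\<close>
  there is the square of that of \<open>p\<close> at \<open>s\<close>.
\<close>

lemma square_eq_zero_coeff:
  fixes p :: "('n::finite, 'f::field_char_0) coeff"
  assumes "p * p = 0" shows "p = 0"
proof (rule ccontr)
  assume "p \<noteq> 0"
  define N where "N s = (\<Sum>k\<in>UNIV. (fst s $ k)\<^sup>2 + (snd s $ k)\<^sup>2)"
    for s :: "(int ^ 'n) \<times> (int ^ 'n)"
  obtain s where s: "s \<in> Poly_Mapping.keys p"
    and max: "\<And>t. t \<in> Poly_Mapping.keys p \<Longrightarrow> N t \<le> N s"
    using ex_maximal_value[of "Poly_Mapping.keys p" N] \<open>p \<noteq> 0\<close> by auto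
  have extreme: "t = s" if t: "t \<in> Poly_Mapping.keys p" "s + s - t \<in> Poly_Mapping.keys p" for t
  proof -
    \<comment> \<open>parallelogram law for the vectors s and t - s\<close>
    have "N (s + s - t) + N t = 2 * N s + 2 * N (t - s)"
      unfolding N_def sum_distrib_left sum.distrib[symmetric]
      by (intro sum.cong refl) (simp add: power2_eq_square algebra_simps)
    then have "N (t - s) \<le> 0"
      using max[OF t(1)] max[OF t(2)] by simp
    moreover have "0 \<le> (fst (t - s) $ k)\<^sup>2 + (snd (t - s) $ k)\<^sup>2" for k
      by simp
    ultimately have "(fst (t - s) $ k)\<^sup>2 + (snd (t - s) $ k)\<^sup>2 = 0" for k
      unfolding N_def using sum_nonneg_eq_0_iff[of UNIV "\<lambda>k. (fst (t - s) $ k)\<^sup>2 + (snd (t - s) $ k)\<^sup>2"]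
      by (smt (verit) UNIV_I finite sum_nonneg)
    then show "t = s"
      by (simp add: sum_power2_eq_zero_iff prod_eq_iff vec_eq_iff)
  qed
  have "Poly_Mapping.lookup (p * p) (s + s)
      = (\<Sum>t\<in>Poly_Mapping.keys p. if t = s then Poly_Mapping.lookup p s * Poly_Mapping.lookup p s else 0)"
    unfolding lookup_mult_keys
    by (intro sum.cong refl) (use extreme in \<open>force simp: in_keys_iff\<close>)
  also have "\<dots> \<noteq> 0"
    using s by (simp add: in_keys_iff)
  finally show False
    using assms by simp
qed

lemma cube_eq_zero_coeff:
  fixes p :: "('n::finite, 'f::field_char_0) coeff"
  assumes "p ^ 3 = 0" shows "p = 0"
proof -
  have "(p * p) * (p * p) = p * p ^ 3"
    by (simp add: power3_eq_cube mult.assoc)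
  then have "p * p = 0"
    using square_eq_zero_coeff[of "p * p"] assms by simp
  then show ?thesis
    by (rule square_eq_zero_coeff)
qed

definition raise_exponent :: "'n::finite \<Rightarrow> (int ^ 'n) \<times> (int ^ 'n) \<Rightarrow> (int ^ 'n) \<times> (int ^ 'n)" where
  "raise_exponent k s = s + (0, axis k 1)"

lemma inj_raise_exponent [simp]: "inj (raise_exponent k)"
  by (simp add: inj_def raise_exponent_def)

text \<open>
  The partial derivative by \<open>x\<^sub>k\<close> of the functions above. The coefficient of the result at
  exponent \<open>i\<close> collects the one at \<open>i\<close> from the exponential factor and the one at \<open>i + \<epsilon>\<^sub>k\<close>
  from the power of \<open>x\<^sub>k\<close>, which is why the second summand reads \<open>p\<close> along \<open>raise_exponent\<close>.
\<close>

definition deriv ::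
  "('n::finite \<Rightarrow> int \<Rightarrow> 'f::field_char_0) \<Rightarrow> 'n \<Rightarrow> ('n, 'f) coeff \<Rightarrow> ('n, 'f) coeff" where
  "deriv g k p = Poly_Mapping.mapp (\<lambda>s c. g k (fst s $ k) * c) p
     + Poly_Mapping.map_key (raise_exponent k) (Poly_Mapping.mapp (\<lambda>s c. of_int (snd s $ k) * c) p)"

lemma lookup_deriv: "Poly_Mapping.lookup (deriv g k p) (a, i)
    = g k (a $ k) * Poly_Mapping.lookup p (a, i)
      + of_int (i $ k + 1) * Poly_Mapping.lookup p (a, i + axis k 1)"
  by (auto simp: deriv_def lookup_add lookup_mapp map_key.rep_eq when_def raise_exponent_def in_keys_iff)

lemma deriv_single:
  fixes g :: "'n::finite \<Rightarrow> int \<Rightarrow> 'f::field_char_0"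
  shows "deriv g k (Poly_Mapping.single (a, i) c)
    = Poly_Mapping.single (a, i) (g k (a $ k) * c)
      + Poly_Mapping.single (a, i - axis k 1) (of_int (i $ k) * c)"
proof (intro poly_mapping_eqI)
  fix t :: "(int ^ 'n) \<times> (int ^ 'n)"
  obtain b j where t: "t = (b, j)"
    by fastforce
  show "Poly_Mapping.lookup (deriv g k (Poly_Mapping.single (a, i) c)) t
    = Poly_Mapping.lookup (Poly_Mapping.single (a, i) (g k (a $ k) * c)
        + Poly_Mapping.single (a, i - axis k 1) (of_int (i $ k) * c)) t"
  proof (cases "i = j + axis k 1")
    case True
    then show ?thesis
      by (simp add: t lookup_deriv lookup_add lookup_single when_def)
  next
    case False
    then have "i - axis k 1 \<noteq> j"
      by (auto simp: algebra_simps)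
    with False show ?thesis
      by (simp add: t lookup_deriv lookup_add lookup_single when_def)
  qed
qed

locale injective_weights =
  fixes g :: "'n::finite \<Rightarrow> int \<Rightarrow> 'f::field_char_0"
  assumes additive_weight: "additive (g p)"
    and inj_weight: "inj (g p)"
begin

lemma weight_add: "g k (x + y) = g k x + g k y"
  using additive.add[OF additive_weight] .

lemma weight_zero [simp]: "g k 0 = 0"
  using additive.zero[OF additive_weight] .

lemma weight_eq_iff [simp]: "g k x = g k y \<longleftrightarrow> x = y"
  using inj_weight by (simp add: inj_eq)

lemma deriv_add: "deriv g k (p + q) = deriv g k p + deriv g k q"
  by (intro poly_mapping_eqI) (auto simp: lookup_deriv lookup_add algebra_simps)

lemma deriv_zero [simp]: "deriv g k 0 = 0"
  by (intro poly_mapping_eqI) (auto simp: lookup_deriv)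

lemma deriv_leibniz_single:
  "deriv g k (Poly_Mapping.single s c * Poly_Mapping.single t e)
    = deriv g k (Poly_Mapping.single s c) * Poly_Mapping.single t e
      + Poly_Mapping.single s c * deriv g k (Poly_Mapping.single t e)"
proof -
  obtain a i b j where s: "s = (a, i)" and t: "t = (b, j)"
    by (cases s, cases t)
  have shift: "i - axis k 1 + j = i + j - axis k 1" "i + (j - axis k 1) = i + j - axis k 1"
    by simp_all
  show ?thesis
    unfolding s t
    by (simp add: mult_single deriv_single weight_add distrib_left distrib_right single_add shift
        mult_ac[where 'a = 'f] add_ac[where 'a = "('n, 'f) coeff"])
qed

sublocale commuting_derivations "deriv g"
proof
  fix k l and p q :: "('n, 'f) coeff"
  show "deriv g k (p + q) = deriv g k p + deriv g k q"
    by (rule deriv_add)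
  show "deriv g k (p * q) = deriv g k p * q + p * deriv g k q"
  proof (induction p rule: poly_mapping_additive_induct)
    case (single s c)
    show ?case
      by (induction q rule: poly_mapping_additive_induct)
        (simp_all add: deriv_leibniz_single deriv_add algebra_simps)
  qed (simp_all add: deriv_add algebra_simps)
  show "deriv g k (deriv g l p) = deriv g l (deriv g k p)"
  proof (cases "k = l")
    case False
    then have "(axis k 1 :: int ^ 'n) $ l = 0" "(axis l 1 :: int ^ 'n) $ k = 0"
      by (auto simp: axis_def)
    then show ?thesis
      by (intro poly_mapping_eqI) (auto simp: lookup_deriv algebra_simps)
  qed simp
qed

lemma deriv_const [simp]: "deriv g k (Poly_Mapping.single 0 c) = 0"
  by (simp add: zero_prod_def deriv_single)

end

section \<open>Differential ideals of the coefficient ring\<close>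

text \<open>
  The support itself may grow under differentiation; adding all nonnegative exponents below those
  that occur gives a finite set that cannot, and its cardinality serves as a measure for descent.
\<close>

definition exponent_hull ::
  "('n::finite, 'f::field_char_0) coeff \<Rightarrow> ((int ^ 'n) \<times> (int ^ 'n)) set" where
  "exponent_hull p = {(a, j). \<exists>i. (a, i) \<in> Poly_Mapping.keys p \<and> (\<forall>l. 0 \<le> j $ l \<and> j $ l \<le> i $ l)}"

lemma finite_exponent_hull: "finite (exponent_hull p)"
proof -
  have box: "finite {j :: int ^ 'n. \<forall>l. 0 \<le> j $ l \<and> j $ l \<le> i $ l}" for i :: "int ^ 'n::finite"
  proof (rule finite_subset)
    show "{j. \<forall>l. 0 \<le> j $ l \<and> j $ l \<le> i $ l} \<subseteq> vec_lambda ` (Pi\<^sub>E UNIV (\<lambda>l. {0..i $ l}))"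
    proof
      fix j assume "j \<in> {j. \<forall>l. 0 \<le> j $ l \<and> j $ l \<le> i $ l}"
      then show "j \<in> vec_lambda ` (Pi\<^sub>E UNIV (\<lambda>l. {0..i $ l}))"
        by (intro image_eqI[of _ _ "vec_nth j"]) auto
    qed
    show "finite (vec_lambda ` (Pi\<^sub>E UNIV (\<lambda>l. {0..i $ l})))"
      by (intro finite_imageI finite_PiE) auto
  qed
  have "exponent_hull p
      = (\<Union>(a, i)\<in>Poly_Mapping.keys p. {a} \<times> {j. \<forall>l. 0 \<le> j $ l \<and> j $ l \<le> i $ l})"
    by (auto simp: exponent_hull_def)
  then show ?thesis
    by (auto intro!: finite_SigmaI box)
qed

definition polynomial :: "('n::finite, 'f::field_char_0) coeff \<Rightarrow> bool" where
  "polynomial p \<longleftrightarrow> (\<forall>(a, i)\<in>Poly_Mapping.keys p. \<forall>l. 0 \<le> i $ l)"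

context injective_weights
begin

text \<open>
  On the coefficients of the \<open>exp\<close> factors with \<open>a\<^sub>k = c\<close> this operator is just the derivative by
  \<open>x\<^sub>k\<close> and lowers the degree in \<open>x\<^sub>k\<close>; on the other ones it is injective.
\<close>

definition shifted_deriv :: "'n \<Rightarrow> int \<Rightarrow> ('n, 'f) coeff \<Rightarrow> ('n, 'f) coeff" where
  "shifted_deriv k c p = deriv g k p - Poly_Mapping.single 0 (g k c) * p"

lemma lookup_shifted_deriv: "Poly_Mapping.lookup (shifted_deriv k c p) (a, i)
    = (g k (a $ k) - g k c) * Poly_Mapping.lookup p (a, i)
      + of_int (i $ k + 1) * Poly_Mapping.lookup p (a, i + axis k 1)"
  by (simp add: shifted_deriv_def lookup_minus lookup_deriv lookup_single_mult left_diff_distrib)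

lemma keys_shifted_deriv:
  assumes "(a, i) \<in> Poly_Mapping.keys (shifted_deriv k c p)"
  shows "a $ k \<noteq> c \<and> (a, i) \<in> Poly_Mapping.keys p
    \<or> i $ k + 1 \<noteq> 0 \<and> (a, i + axis k 1) \<in> Poly_Mapping.keys p"
  using assms unfolding in_keys_iff lookup_shifted_deriv by (auto simp del: of_int_add)

lemma polynomial_shifted_deriv:
  assumes "polynomial p" shows "polynomial (shifted_deriv k c p)"
  unfolding polynomial_def
proof (clarify)
  fix a i l assume "(a, i) \<in> Poly_Mapping.keys (shifted_deriv k c p)"
  from keys_shifted_deriv[OF this] show "0 \<le> i $ l"
  proof (elim disjE conjE)
    assume "i $ k + 1 \<noteq> 0" "(a, i + axis k 1) \<in> Poly_Mapping.keys p"
    then have "0 \<le> (i + axis k 1) $ l" "i $ k \<noteq> - 1"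
      using assms by (auto simp: polynomial_def)
    then show ?thesis
      by (cases "l = k") (auto simp: axis_def)
  qed (use assms in \<open>auto simp: polynomial_def\<close>)
qed

lemma ex_maximal_exponent:
  fixes p :: "('n, 'f) coeff"
  assumes "(a, i) \<in> Poly_Mapping.keys p"
  obtains j where "(a, j) \<in> Poly_Mapping.keys p"
    and "\<And>j'. (a, j') \<in> Poly_Mapping.keys p \<Longrightarrow> j' $ k \<le> j $ k"
proof -
  let ?S = "{s \<in> Poly_Mapping.keys p. fst s = a}"
  have "finite ?S" "?S \<noteq> {}"
    using assms by auto
  then obtain s where "s \<in> ?S" "\<forall>t\<in>?S. snd t $ k \<le> snd s $ k"
    using ex_maximal_value[of ?S "\<lambda>s. snd s $ k"] by blast
  then show ?thesis
    by (intro that[of "snd s"]) force+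
qed

text \<open>
  Among the keys with first component \<open>a\<close> one with the largest \<open>k\<close>-th exponent is lost, since there the
  operator only lowers that exponent.
\<close>

lemma exponent_hull_shifted_deriv:
  assumes p: "polynomial p" and key: "(a, i) \<in> Poly_Mapping.keys p"
  shows "exponent_hull (shifted_deriv k (a $ k) p) \<subset> exponent_hull p"
proof -
  have "exponent_hull (shifted_deriv k (a $ k) p) \<subseteq> exponent_hull p"
  proof (clarify)
    fix b j assume "(b, j) \<in> exponent_hull (shifted_deriv k (a $ k) p)"
    then obtain i' where i': "(b, i') \<in> Poly_Mapping.keys (shifted_deriv k (a $ k) p)"
      and j: "\<And>l. 0 \<le> j $ l \<and> j $ l \<le> i' $ l"
      by (auto simp: exponent_hull_def)
    have "j $ l \<le> (i' + axis k 1) $ l" for l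
      using j[of l] by (auto simp: axis_def)
    with keys_shifted_deriv[OF i'] j show "(b, j) \<in> exponent_hull p"
      unfolding exponent_hull_def by blast
  qed
  moreover obtain j where j: "(a, j) \<in> Poly_Mapping.keys p"
    and max: "\<And>j'. (a, j') \<in> Poly_Mapping.keys p \<Longrightarrow> j' $ k \<le> j $ k"
    using ex_maximal_exponent[OF key] by blast
  have "0 \<le> j $ l" for l
    using p j by (auto simp: polynomial_def)
  then have "(a, j) \<in> exponent_hull p"
    using j by (auto simp: exponent_hull_def)
  moreover have "(a, j) \<notin> exponent_hull (shifted_deriv k (a $ k) p)"
  proof
    assume "(a, j) \<in> exponent_hull (shifted_deriv k (a $ k) p)"
    then obtain i' where i': "(a, i') \<in> Poly_Mapping.keys (shifted_deriv k (a $ k) p)" and "j $ k \<le> i' $ k"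
      by (auto simp: exponent_hull_def)
    then show False
      using keys_shifted_deriv[OF i'] max[of "i' + axis k 1"] by auto
  qed
  ultimately show ?thesis
    by blast
qed

text \<open>
  If the first components differ from \<open>c\<close> at \<open>k\<close>, then injectivity of \<open>g k\<close> makes the coefficient at \<open>j\<close>
  determine a nonzero one at \<open>j + \<epsilon>\<^sub>k\<close>, which is impossible for the largest \<open>j\<close>. For \<open>a\<^sub>k = c\<close>
  only the power rule remains: \<open>i\<^sub>k\<close> annihilates a nonzero coefficient, so it is zero in \<open>F\<close> and,
  by characteristic zero, as an integer.
\<close>

lemma shifted_deriv_eq_zero_keys:
  assumes zero: "shifted_deriv k c p = 0" and key: "(a, i) \<in> Poly_Mapping.keys p"
  shows "a $ k = c" "i $ k = 0"
proof -
  have coeff: "(g k (b $ k) - g k c) * Poly_Mapping.lookup p (b, j)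
      + of_int (j $ k + 1) * Poly_Mapping.lookup p (b, j + axis k 1) = 0" for b j
    using lookup_shifted_deriv[of k c p b j] zero by simp
  show a: "a $ k = c"
  proof (rule ccontr)
    assume "a $ k \<noteq> c"
    obtain j where j: "(a, j) \<in> Poly_Mapping.keys p"
      and max: "\<And>j'. (a, j') \<in> Poly_Mapping.keys p \<Longrightarrow> j' $ k \<le> j $ k"
      using ex_maximal_exponent[OF key] by blast
    have "Poly_Mapping.lookup p (a, j + axis k 1) = 0"
      using max[of "j + axis k 1"] by (auto simp: in_keys_iff)
    then show False
      using coeff[of a j] \<open>a $ k \<noteq> c\<close> j by (simp add: in_keys_iff)
  qed
  show "i $ k = 0"
    using coeff[of a "i - axis k 1"] a key by (simp add: in_keys_iff)
qed

text \<open>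
  Monomials are units, so negative exponents can be cleared inside the ideal. For \<open>N\<close> the sum of all
  absolute values is a convenient bound.
\<close>

lemma ex_polynomial_in_ideal:
  assumes J: "differential_ideal J" and p: "p \<in> J" "p \<noteq> 0"
  obtains q where "q \<in> J" "q \<noteq> 0" "polynomial q"
proof -
  define N :: "int ^ 'n" where "N = (\<chi> l. \<Sum>s\<in>Poly_Mapping.keys p. \<bar>snd s $ l\<bar>)"
  define q where "q = Poly_Mapping.single (0, N) 1 * p"
  have "Poly_Mapping.single (0, - N) 1 * q = p"
    by (simp add: q_def mult_single flip: mult.assoc zero_prod_def)
  with p have "q \<noteq> 0"
    by auto
  moreover have "q \<in> J"
    using J p by (simp add: q_def differential_ideal_def)
  moreover have "polynomial q"
    unfolding polynomial_def
  proof (clarify)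
    fix a i l assume "(a, i) \<in> Poly_Mapping.keys q"
    then have "(a, i - N) \<in> Poly_Mapping.keys p"
      by (simp add: q_def in_keys_iff lookup_single_mult)
    then have "\<bar>(i - N) $ l\<bar> \<le> N $ l"
      using member_le_sum[of "(a, i - N)" "Poly_Mapping.keys p" "\<lambda>s. \<bar>snd s $ l\<bar>"]
      by (simp add: N_def)
    then show "0 \<le> i $ l"
      by simp
  qed
  ultimately show ?thesis
    using that by blast
qed

text \<open>
  An element \<open>q\<close> of the ideal with smallest hull is killed by every shifted derivative that would shrink
  the hull. This forces its support to be a single key \<open>(a, 0)\<close>, and such a monomial is a unit.
\<close>

theorem one_in_differential_ideal:
  assumes J: "differential_ideal J" and p: "p \<in> J" "p \<noteq> 0"
  shows "1 \<in> J"
proof -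
  let ?Q = "\<lambda>q. q \<in> J \<and> q \<noteq> 0 \<and> polynomial q"
  obtain q0 where "?Q q0"
    using ex_polynomial_in_ideal[OF assms] by blast
  then obtain q where q: "q \<in> J" "q \<noteq> 0" "polynomial q"
    and min: "\<And>q'. ?Q q' \<Longrightarrow> card (exponent_hull q) \<le> card (exponent_hull q')"
    using ex_has_least_nat[of ?Q q0 "\<lambda>q. card (exponent_hull q)"] by blast
  have shifted_deriv_in: "shifted_deriv k c q \<in> J" for k c
  proof -
    have "shifted_deriv k c q = deriv g k q + Poly_Mapping.single 0 (- g k c) * q"
      by (simp add: shifted_deriv_def single_uminus)
    then show ?thesis
      using J q by (simp add: differential_ideal_def)
  qed
  have shifted_deriv_zero: "shifted_deriv k (a $ k) q = 0" if "(a, i) \<in> Poly_Mapping.keys q" for a i k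
  proof (rule ccontr)
    assume "shifted_deriv k (a $ k) q \<noteq> 0"
    then have "card (exponent_hull q) \<le> card (exponent_hull (shifted_deriv k (a $ k) q))"
      by (intro min conjI shifted_deriv_in polynomial_shifted_deriv q)
    then show False
      using psubset_card_mono[OF finite_exponent_hull exponent_hull_shifted_deriv[OF q(3) that]]
      by (simp add: not_less[symmetric])
  qed
  obtain a i where key: "(a, i) \<in> Poly_Mapping.keys q"
    using q(2) by (metis ex_in_conv keys_eq_empty surj_pair)
  have "s = (a, 0)" if "s \<in> Poly_Mapping.keys q" for s
    using shifted_deriv_eq_zero_keys[OF shifted_deriv_zero[OF key], of "fst s" "snd s"] that
    by (auto simp: prod_eq_iff vec_eq_iff)
  then have "Poly_Mapping.keys q = {(a, 0)}"
    using key by blast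
  define c where "c = Poly_Mapping.lookup q (a, 0)"
  have "(a, 0) \<in> Poly_Mapping.keys q"
    using \<open>Poly_Mapping.keys q = {(a, 0)}\<close> by simp
  then have "c \<noteq> 0"
    by (simp add: c_def in_keys_iff)
  have "Poly_Mapping.lookup q s = Poly_Mapping.lookup (Poly_Mapping.single (a, 0) c) s" for s
  proof (cases "s = (a, 0)")
    case False
    then have "s \<notin> Poly_Mapping.keys q"
      using \<open>Poly_Mapping.keys q = {(a, 0)}\<close> by simp
    with False show ?thesis
      by (simp add: in_keys_iff lookup_single)
  qed (simp add: c_def)
  then have "q = Poly_Mapping.single (a, 0) c"
    by (rule poly_mapping_eqI)
  then have "Poly_Mapping.single (- a, 0) (1 / c) * q = 1"
    using \<open>c \<noteq> 0\<close> by (simp add: mult_single flip: zero_prod_def)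
  then show ?thesis
    using J q(1) by (metis differential_ideal_def)
qed

end

section \<open>The Lie algebra as vector fields over the coefficient ring\<close>

lemma W_scale_zero_left [simp]: "W_scale 0 u = 0"
  by (intro poly_mapping_eqI) simp

lemma W_scale_left_add: "W_scale (c + e) u = W_scale c u + W_scale e u"
  by (intro poly_mapping_eqI) (simp add: lookup_add algebra_simps)

text \<open>
  Summing over the exact supports hides bilinearity; over a common larger set each summand is additive
  in the coefficients.
\<close>

lemma W_bracket_superset:
  assumes "finite S" "Poly_Mapping.keys u \<subseteq> S" "finite T" "Poly_Mapping.keys v \<subseteq> T"
  shows "W_bracket g u v = (\<Sum>s\<in>S. \<Sum>t\<in>T.
    W_scale (Poly_Mapping.lookup u s * Poly_Mapping.lookup v t) (W_symbol_bracket g s t))"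
proof -
  have "(\<Sum>t\<in>Poly_Mapping.keys v.
        W_scale (Poly_Mapping.lookup u s * Poly_Mapping.lookup v t) (W_symbol_bracket g s t))
      = (\<Sum>t\<in>T. W_scale (Poly_Mapping.lookup u s * Poly_Mapping.lookup v t) (W_symbol_bracket g s t))" for s
    using assms by (intro sum.mono_neutral_left) (auto simp: in_keys_iff)
  then show ?thesis
    unfolding W_bracket_def using assms
    by (simp, intro sum.mono_neutral_left) (auto simp: in_keys_iff)
qed

lemma W_bracket_add_left: "W_bracket g (u + v) w = W_bracket g u w + W_bracket g v w"
proof -
  let ?S = "Poly_Mapping.keys u \<union> Poly_Mapping.keys v" and ?T = "Poly_Mapping.keys w"
  have "W_bracket g x w = (\<Sum>s\<in>?S. \<Sum>t\<in>?T.
      W_scale (Poly_Mapping.lookup x s * Poly_Mapping.lookup w t) (W_symbol_bracket g s t))"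
    if "Poly_Mapping.keys x \<subseteq> ?S" for x
    using that by (intro W_bracket_superset) auto
  from this[of u] this[of v] this[of "u + v"] show ?thesis
    by (simp add: Poly_Mapping.keys_add lookup_add distrib_right W_scale_left_add sum.distrib)
qed

lemma W_bracket_add_right: "W_bracket g w (u + v) = W_bracket g w u + W_bracket g w v"
proof -
  let ?S = "Poly_Mapping.keys w" and ?T = "Poly_Mapping.keys u \<union> Poly_Mapping.keys v"
  have "W_bracket g w x = (\<Sum>s\<in>?S. \<Sum>t\<in>?T.
      W_scale (Poly_Mapping.lookup w s * Poly_Mapping.lookup x t) (W_symbol_bracket g s t))"
    if "Poly_Mapping.keys x \<subseteq> ?T" for x
    using that by (intro W_bracket_superset) auto
  from this[of u] this[of v] this[of "u + v"] show ?thesis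
    by (simp add: Poly_Mapping.keys_add lookup_add distrib_left W_scale_left_add sum.distrib)
qed

lemma W_bracket_zero [simp]: "W_bracket g 0 v = 0" "W_bracket g u 0 = 0"
  by (simp_all add: W_bracket_def)

lemma W_bracket_single: "W_bracket g (Poly_Mapping.single s c) (Poly_Mapping.single t e)
    = W_scale (c * e) (W_symbol_bracket g s t)"
  by (subst W_bracket_superset[of "{s}" _ "{t}"]) auto

text \<open>
  The symbol with rows \<open>a\<close>, \<open>i\<close> and index \<open>k\<close> becomes the monomial \<open>(a, i)\<close> times the derivation
  \<open>d\<^sub>k\<close>; sorting by \<open>k\<close> identifies \<open>W\<close> with vectors over the coefficient ring.
\<close>

definition vector_field :: "('n::finite, 'f::field_char_0) W \<Rightarrow> ('n, 'f) coeff ^ 'n" where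
  "vector_field u = (\<chi> k. Poly_Mapping.map_key (\<lambda>(a, i). (a, i, k)) u)"

lemma lookup_vector_field [simp]:
  "Poly_Mapping.lookup (vector_field u $ k) (a, i) = Poly_Mapping.lookup u (a, i, k)"
  by (simp add: vector_field_def map_key.rep_eq inj_def)

lemma vector_field_eqI:
  assumes "\<And>k a i. Poly_Mapping.lookup (x $ k) (a, i) = Poly_Mapping.lookup (y $ k) (a, i)"
  shows "x = y"
  using assms by (auto simp: vec_eq_iff intro!: poly_mapping_eqI)

lemma bij_vector_field: "bij (vector_field :: ('n::finite, 'f::field_char_0) W \<Rightarrow> _)"
proof (rule bijI)
  show "inj (vector_field :: ('n, 'f) W \<Rightarrow> _)"
  proof (rule injI)
    fix u v :: "('n, 'f) W"
    assume "vector_field u = vector_field v"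
    then have "Poly_Mapping.lookup u (a, i, k) = Poly_Mapping.lookup v (a, i, k)" for a i k
      by (metis lookup_vector_field)
    then show "u = v"
      by (auto intro!: poly_mapping_eqI)
  qed
  show "surj (vector_field :: ('n, 'f) W \<Rightarrow> _)"
  proof (rule surjI)
    fix w :: "('n, 'f) coeff ^ 'n"
    let ?f = "\<lambda>(a, i, k). Poly_Mapping.lookup (w $ k) (a, i)"
    have "{s. ?f s \<noteq> 0} \<subseteq> (\<Union>k. (\<lambda>(a, i). (a, i, k)) ` Poly_Mapping.keys (w $ k))"
      by (force simp: in_keys_iff)
    then have "finite {s. ?f s \<noteq> 0}"
      by (rule finite_subset) auto
    then show "vector_field (Abs_poly_mapping ?f) = w"
      by (intro vector_field_eqI) simp
  qed
qed

lemma vector_field_add: "vector_field (u + v) = vector_field u + vector_field v"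
  by (rule vector_field_eqI) (simp add: lookup_add)

lemma vector_field_diff: "vector_field (u - v) = vector_field u - vector_field v"
  by (rule vector_field_eqI) (simp add: lookup_minus)

lemma vector_field_zero [simp]: "vector_field 0 = 0"
  by (rule vector_field_eqI) simp

lemma vector_field_scale: "vector_field (W_scale c u) = Poly_Mapping.single 0 c *s vector_field u"
  by (rule vector_field_eqI) (simp add: lookup_single_mult)

lemma vector_field_single:
  "vector_field (Poly_Mapping.single (a, i, k) c) = axis k (Poly_Mapping.single (a, i) c)"
  by (rule vector_field_eqI) (auto simp: axis_def lookup_single when_def)

lemma vector_field_eq_iff: "vector_field u = vector_field v \<longleftrightarrow> u = v"
  using bij_vector_field by (metis bij_is_inj injD)

context injective_weights
begin

text \<open>
  This is the only place where the structure constants of \<open>W\<close> enter: they are those of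
  \<open>[p d\<^sub>k, q d\<^sub>l] = p d\<^sub>k(q) d\<^sub>l - q d\<^sub>l(p) d\<^sub>k\<close> for monomials \<open>p\<close> and \<open>q\<close>, with
  \<open>d\<^sub>k(q)\<close> given by \<open>deriv_single\<close>.
\<close>

lemma vector_field_symbol_bracket:
  "vector_field (W_scale (c * e) (W_symbol_bracket g (a, i, k) (b, j, l)))
    = lie (axis k (Poly_Mapping.single (a, i) c)) (axis l (Poly_Mapping.single (b, j) e))"
proof -
  have axis: "axis m p + axis m q = axis m (p + q)"
      "(r :: ('n, 'f) coeff) *s axis m p = axis m (r * p)" for m p q r
    by (auto simp: axis_def vec_eq_iff)
  have shift: "i + (j - axis k 1) = i + j - axis k 1" "j + (i - axis l 1) = i + j - axis l 1"
      "b + a = a + b" "j + i = i + j"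
    by simp_all
  show ?thesis
    unfolding W_symbol_bracket.simps vector_field_scale vector_field_diff vector_field_add
      vector_field_single lie_axis deriv_single distrib_left mult_single add_Pair shift
    by (simp add: vector_ssub_ldistrib vector_add_ldistrib axis(2) mult_single mult_ac
        flip: axis(1))
qed

theorem vector_field_bracket:
  "vector_field (W_bracket g u v) = lie (vector_field u) (vector_field v)"
proof (induction u rule: poly_mapping_additive_induct)
  case (single s c)
  show ?case
  proof (induction v rule: poly_mapping_additive_induct)
    case (single t e)
    show ?case
      by (cases s; cases t)
        (simp only: W_bracket_single vector_field_symbol_bracket vector_field_single)
  next
    case zero
    show ?case
      using lie_add_right[of _ 0 0] by simp
  qed (simp_all add: W_bracket_add_right vector_field_add lie_add_right)
next
  case zero
  show ?case
    using lie_add_left[of 0 0] by simp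
qed (simp_all add: W_bracket_add_left vector_field_add lie_add_left)

lemma act_const [simp]: "act u (Poly_Mapping.single 0 c) = 0"
  by (simp add: act_def)

lemma lie_algebra_W: "lie_algebra W_scale (W_bracket g)"
proof -
  interpret vector_space "W_scale :: 'f \<Rightarrow> ('n, 'f) W \<Rightarrow> _"
    by (rule vector_space_W_scale)
  show ?thesis
  proof
    fix x y z :: "('n, 'f) W" and c :: 'f
    show "W_bracket g x (y + z) = W_bracket g x y + W_bracket g x z"
      by (rule W_bracket_add_right)
    show "W_bracket g (y + z) x = W_bracket g y x + W_bracket g z x"
      by (rule W_bracket_add_left)
    have "vector_field (W_bracket g x (W_scale c y)) = vector_field (W_scale c (W_bracket g x y))"
      by (simp add: vector_field_bracket vector_field_scale lie_smult_right)
    then show "W_bracket g x (W_scale c y) = W_scale c (W_bracket g x y)"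
      by (simp only: vector_field_eq_iff)
    have "vector_field (W_bracket g (W_scale c x) y) = vector_field (W_scale c (W_bracket g x y))"
      by (simp add: vector_field_bracket vector_field_scale lie_smult_left)
    then show "W_bracket g (W_scale c x) y = W_scale c (W_bracket g x y)"
      by (simp only: vector_field_eq_iff)
    have "vector_field (W_bracket g x x) = vector_field 0"
      by (simp add: vector_field_bracket)
    then show "W_bracket g x x = 0"
      by (simp only: vector_field_eq_iff)
    have "vector_field (W_bracket g x (W_bracket g y z) + W_bracket g y (W_bracket g z x)
        + W_bracket g z (W_bracket g x y)) = vector_field 0"
      by (simp add: vector_field_bracket vector_field_add lie_jacobi)
    then show "W_bracket g x (W_bracket g y z) + W_bracket g y (W_bracket g z x)
        + W_bracket g z (W_bracket g x y) = 0"
      by (simp only: vector_field_eq_iff)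
  qed
qed

text \<open>
  The exponential with weight \<open>\<epsilon>\<^sub>k\<close> is an eigenvector of \<open>d\<^sub>k\<close> with eigenvalue \<open>g\<^sub>k(1)\<close> and
  constant for the other derivations, so acting on it isolates one component of the field up to a unit.
\<close>

lemma act_exponential: "act u (Poly_Mapping.single (axis k 1, 0) 1)
    = u $ k * Poly_Mapping.single (axis k 1, 0) (g k 1)"
proof -
  have "act u (Poly_Mapping.single (axis k 1, 0) 1)
      = (\<Sum>l\<in>UNIV. if l = k then u $ k * Poly_Mapping.single (axis k 1, 0) (g k 1) else 0)"
    unfolding act_def by (intro sum.cong refl) (auto simp: deriv_single axis_def)
  then show ?thesis
    by simp
qed

lemma weight_one_nonzero: "g k 1 \<noteq> 0"
  using weight_eq_iff[of k 1 0] by simp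

lemma act_cube_nonzero:
  assumes "u \<noteq> 0"
  obtains f where "4 * act u f ^ 3 \<noteq> 0"
proof -
  obtain k where "u $ k \<noteq> 0"
    using assms by (auto simp: vec_eq_iff)
  let ?s = "(axis k 1, 0) :: (int ^ 'n) \<times> (int ^ 'n)"
  define p where "p = act u (Poly_Mapping.single ?s 1)"
  have "p * Poly_Mapping.single (- ?s) (1 / g k 1) = u $ k"
    using weight_one_nonzero
    by (simp add: p_def act_exponential mult.assoc mult_single flip: zero_prod_def)
  with \<open>u $ k \<noteq> 0\<close> have "p \<noteq> 0"
    by auto
  then have "p ^ 3 \<noteq> 0"
    using cube_eq_zero_coeff by blast
  then obtain s where "Poly_Mapping.lookup (p ^ 3) s \<noteq> 0"
    by (metis poly_mapping_eqI lookup_zero)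
  moreover have "4 * p ^ 3 = p ^ 3 + p ^ 3 + p ^ 3 + p ^ 3"
    by simp
  then have "Poly_Mapping.lookup (4 * p ^ 3) s = 4 * Poly_Mapping.lookup (p ^ 3) s"
    by (simp only: lookup_add) simp
  ultimately have "4 * p ^ 3 \<noteq> 0"
    by auto
  then show ?thesis
    unfolding p_def by (rule that)
qed

text \<open>
  Some \<open>4 u(f)\<^sup>3\<close> is nonzero for a nonzero \<open>u\<close> of the ideal, so the conductor of the ideal is a
  nonzero differential ideal and contains \<open>1\<close>.
\<close>

theorem simple_lie_algebra_W: "simple_lie_algebra W_scale (W_bracket g)"
proof -
  interpret W: lie_algebra W_scale "W_bracket g"
    by (rule lie_algebra_W)
  show ?thesis
  proof
    obtain k :: 'n where True by simp
    let ?x = "Poly_Mapping.single (0, 0, k) 1 :: ('n, 'f) W"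
    let ?y = "Poly_Mapping.single (axis k 1, 0, k) 1 :: ('n, 'f) W"
    \<comment> \<open>the derivation d k applied to an exponential\<close>
    have "W_bracket g ?x ?y = Poly_Mapping.single (axis k 1, 0, k) (g k 1)"
      by (simp add: W_bracket_symbols)
    then have "Poly_Mapping.lookup (W_bracket g ?x ?y) (axis k 1, 0, k) \<noteq> 0"
      using weight_one_nonzero by simp
    then show "\<exists>x y. W_bracket g x y \<noteq> 0"
      by (metis lookup_zero)
  next
    fix I assume "W.lie_ideal I"
    then have I: "0 \<in> I" "\<And>u v. u \<in> I \<Longrightarrow> v \<in> I \<Longrightarrow> u - v \<in> I"
        "\<And>w u. u \<in> I \<Longrightarrow> W_bracket g w u \<in> I"
      by (auto simp: W.lie_ideal_def W.subspace_0 W.subspace_diff)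
    have ideal: "vector_field_ideal (vector_field ` I)"
      unfolding vector_field_ideal_def
    proof (intro conjI ballI allI)
      show "0 \<in> vector_field ` I"
        using I(1) by (metis image_eqI vector_field_zero)
      show "x - y \<in> vector_field ` I" if "x \<in> vector_field ` I" "y \<in> vector_field ` I" for x y
        using that I(2) by (auto simp flip: vector_field_diff)
      show "lie w x \<in> vector_field ` I" if "x \<in> vector_field ` I" for w x
      proof -
        obtain w' where "w = vector_field w'"
          using bij_vector_field by (metis bij_pointE)
        then show ?thesis
          using that I(3) by (auto simp flip: vector_field_bracket)
      qed
    qed
    show "I = {0} \<or> I = UNIV"
    proof (rule disjCI)
      assume "I \<noteq> UNIV"
      have "u = 0" if "u \<in> I" for u
      proof (rule ccontr)
        assume "u \<noteq> 0"
        then have "vector_field u \<noteq> 0"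
          using vector_field_eq_iff[of u 0] by simp
        then obtain f where "4 * act (vector_field u) f ^ 3 \<noteq> 0"
          by (rule act_cube_nonzero)
        have "vector_field ` I = UNIV"
        proof (rule vector_field_ideal_eq_UNIV[OF ideal])
          show "1 \<in> J" if "differential_ideal J" "p \<in> J" "p \<noteq> 0" for J p
            using that by (rule one_in_differential_ideal)
          show "vector_field u \<in> vector_field ` I"
            using that by simp
        qed fact
        then have "v \<in> I" for v
          using inj_image_mem_iff[OF bij_is_inj[OF bij_vector_field], of v I] by simp
        with \<open>I \<noteq> UNIV\<close> show False
          by auto
      qed
      with I(1) show "I = {0}"
        by auto
    qed
  qed
qed

end

theorem theorem1:
  fixes g :: "'n::finite \<Rightarrow> int \<Rightarrow> 'f::field_char_0"
  assumes "\<And>p. additive (g p)"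
    and "\<And>p. inj (g p)"
  shows "simple_lie_algebra W_scale (W_bracket g)"
proof -
  interpret injective_weights g
    using assms by (rule injective_weights.intro)
  show ?thesis
    by (rule simple_lie_algebra_W)
qed

end
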